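(* Let $\mathcal{H}$ be a complex Hilbert space, let $A$ be a subnormal bounded linear operator on $\mathcal{H}$, and let $n$ be an integer greater than $1$. Assume that $A^n$ is quasinormal. Then $A$ is quasinormal.
   Context: All operators are bounded linear operators on complex Hilbert spaces (not assumed separable). An operator $A$ on $\mathcal{H}$ is subnormal if it is (unitarily equivalent to) the restriction of a normal operator to a closed invariant subspace; that is, up to unitary equivalence, there are a Hilbert space $\mathcal{K}\supseteq\mathcal{H}$ and a normal bounded operator $N$ on $\mathcal{K}$ with $N\mathcal{H}\subseteq\mathcal{H}$ and $N|_{\mathcal{H}}=A$. An operator $A$ is quasinormal if $A(A^*A)=(A^*A)A$. *)

theory Defs
  imports "HOL-Analysis.Analysis"
begin

text \<open>The norm and the metric come from \<^class>\<open>real_inner\<close>; the axiom \<open>inner_eq_Re_cinner\<close>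
  makes them the ones induced by \<open>cinner\<close>: by \<open>cinner_commute\<close> the number \<open>cinner x x\<close> is real,
  so it equals \<open>inner x x\<close>, the square of \<open>norm x\<close>. This also yields positive definiteness.
  The complex inner product is linear in its first argument.\<close>

class complex_inner = real_inner +
  fixes scaleC :: "complex \<Rightarrow> 'a \<Rightarrow> 'a"  (infixr \<open>*\<^sub>C\<close> 75)
    and cinner :: "'a \<Rightarrow> 'a \<Rightarrow> complex"
  assumes scaleC_add_right: "c *\<^sub>C (x + y) = c *\<^sub>C x + c *\<^sub>C y"
    and scaleC_add_left: "(c + d) *\<^sub>C x = c *\<^sub>C x + d *\<^sub>C x"
    and scaleC_scaleC: "c *\<^sub>C (d *\<^sub>C x) = (c * d) *\<^sub>C x"
    and scaleC_of_real: "complex_of_real r *\<^sub>C x = r *\<^sub>R x"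
    and cinner_add_left: "cinner (x + y) z = cinner x z + cinner y z"
    and cinner_scaleC_left: "cinner (c *\<^sub>C x) y = c * cinner x y"
    and cinner_commute: "cinner x y = cnj (cinner y x)"
    and inner_eq_Re_cinner: "inner x y = Re (cinner x y)"

class chilbert_space = complex_inner + banach

instantiation complex :: chilbert_space
begin
definition scaleC_complex :: "complex \<Rightarrow> complex \<Rightarrow> complex" where
  "scaleC_complex c x = c * x"
definition cinner_complex :: "complex \<Rightarrow> complex \<Rightarrow> complex" where
  "cinner_complex x y = x * cnj y"
instance
  by standard
    (auto simp: scaleC_complex_def cinner_complex_def algebra_simps scaleR_conv_of_real inner_complex_def)
end

definition bounded_clinear :: "('a::complex_inner \<Rightarrow> 'b::complex_inner) \<Rightarrow> bool" where
  "bounded_clinear f \<longleftrightarrow> bounded_linear f \<and> (\<forall>c x. f (c *\<^sub>C x) = c *\<^sub>C f x)"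

text \<open>For bounded operators on a Hilbert space, the adjoint exists and is unique by the Riesz
  representation theorem; the value is unspecified for other functions.\<close>

definition cadjoint :: "('a::chilbert_space \<Rightarrow> 'a) \<Rightarrow> 'a \<Rightarrow> 'a" where
  "cadjoint A = (THE B. \<forall>x y. cinner (A x) y = cinner x (B y))"

definition normal_operator :: "('a::chilbert_space \<Rightarrow> 'a) \<Rightarrow> bool" where
  "normal_operator N \<longleftrightarrow> N \<circ> cadjoint N = cadjoint N \<circ> N"

definition quasinormal :: "('a::chilbert_space \<Rightarrow> 'a) \<Rightarrow> bool" where
  "quasinormal A \<longleftrightarrow> A \<circ> (cadjoint A \<circ> A) = (cadjoint A \<circ> A) \<circ> A"

text \<open>\<open>subnormal TYPE('k) A\<close>: the operator \<open>A\<close> has a normal extension acting on the Hilbert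
  space \<open>'k\<close>. The linear isometry \<open>V\<close> identifies \<open>'h\<close> unitarily with \<open>range V\<close>, which is a
  closed subspace of \<open>'k\<close> because \<open>'h\<close> is complete. HOL cannot quantify existentially over types,
  so the extension space is a parameter; a theorem with \<open>subnormal TYPE('k) A\<close> as a hypothesis
  and a conclusion not mentioning \<open>'k\<close> covers every possible extension space.\<close>

definition subnormal :: "'k::chilbert_space itself \<Rightarrow> ('h::chilbert_space \<Rightarrow> 'h) \<Rightarrow> bool" where
  "subnormal (_ :: 'k itself) A \<longleftrightarrow>
    (\<exists>(V :: 'h \<Rightarrow> 'k) (N :: 'k \<Rightarrow> 'k).
       bounded_clinear V \<and> (\<forall>x. norm (V x) = norm x) \<and>
       bounded_clinear N \<and> normal_operator N \<and>
       N ` range V \<subseteq> range V \<and> (\<forall>x. N (V x) = V (A x)))"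

end

theory Submission
  imports Defs
begin

text \<open>Let \<open>N\<close> be a normal extension of \<open>A\<close>, put \<open>Q = N\<^sup>* N\<close> and \<open>B = A\<^sup>n\<close>. Compressing \<open>Q\<^sup>n\<close> to the
  space of \<open>A\<close> gives \<open>B\<^sup>* B\<close>, and quasinormality of \<open>B\<close> says that \<open>Q\<^sup>n x\<close> has the same norm as its
  compression, so \<open>Q\<^sup>n\<close> leaves that space invariant. The positive operator \<open>Q\<close> is a strong limit of
  polynomials in \<open>Q\<^sup>n\<close>, hence it leaves the space invariant too. Then \<open>A\<^sup>* A\<close> is the restriction of \<open>Q\<close>,
  which commutes with \<open>N\<close>.

  In place of the spectral theorem, inequalities between polynomials in \<open>Q\<close> are certified by
  sums of squares.\<close>

section \<open>Riesz representation and the adjoint\<close>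

lemma parallelogram_law_inner:
  fixes x y :: "'a::real_inner"
  shows "(norm (x - y))\<^sup>2 = 2 * (norm x)\<^sup>2 + 2 * (norm y)\<^sup>2 - (norm (x + y))\<^sup>2"
  by (simp add: power2_norm_eq_inner inner_add_left inner_add_right inner_diff_left inner_diff_right)

text \<open>A minimizing sequence is Cauchy: midpoints stay in the convex set, so their norm is at
  least \<open>d\<close>, and the parallelogram law then bounds the distance of two terms.\<close>

lemma closed_convex_minimal_norm:
  fixes S :: "'a::{real_inner,banach} set"
  assumes S: "closed S" "convex S" "S \<noteq> {}"
  obtains z where "z \<in> S" "\<And>x. x \<in> S \<Longrightarrow> norm z \<le> norm x"
proof -
  define d where "d = (INF x\<in>S. norm x)"
  have bdd: "bdd_below (norm ` S)" by (rule bdd_belowI[of _ 0]) auto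
  have d_le: "d \<le> norm x" if "x \<in> S" for x
    unfolding d_def using that bdd by (rule cINF_lower[rotated])
  have d0: "d \<ge> 0" unfolding d_def using S(3) by (intro cINF_greatest) auto
  have "\<exists>x\<in>S. norm x < d + inverse (real (Suc k))" for k
  proof -
    have "d < d + inverse (real (Suc k))" by simp
    then show ?thesis unfolding d_def using cINF_less_iff[OF S(3) bdd] by blast
  qed
  then obtain s where s: "\<And>k. s k \<in> S" "\<And>k. norm (s k) < d + inverse (real (Suc k))"
    by metis
  have lim: "(\<lambda>k. norm (s k)) \<longlonglongrightarrow> d"
  proof (rule real_tendsto_sandwich)
    show "\<forall>\<^sub>F k in sequentially. d \<le> norm (s k)" using s(1) d_le by simp
    show "\<forall>\<^sub>F k in sequentially. norm (s k) \<le> d + inverse (real (Suc k))"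
      using s(2) by (simp add: less_imp_le)
    show "(\<lambda>k. d + inverse (real (Suc k))) \<longlonglongrightarrow> d"
      using tendsto_add[OF tendsto_const LIMSEQ_inverse_real_of_nat, of d] by simp
  qed simp
  have mid: "(norm (s i - s j))\<^sup>2 \<le> 2 * (norm (s i))\<^sup>2 + 2 * (norm (s j))\<^sup>2 - 4 * d\<^sup>2" for i j
  proof -
    have "(1/2) *\<^sub>R s i + (1/2) *\<^sub>R s j \<in> S"
      using S(2) s(1) by (intro convexD) auto
    then have "d \<le> norm ((1/2) *\<^sub>R (s i + s j))"
      using d_le by (simp add: scaleR_add_right)
    then have "2 * d \<le> norm (s i + s j)" by simp
    then have "(2 * d)\<^sup>2 \<le> (norm (s i + s j))\<^sup>2" using d0 by (intro power_mono) auto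
    then show ?thesis using parallelogram_law_inner[of "s i" "s j"] by (simp add: power_mult_distrib)
  qed
  have "Cauchy s"
  proof (rule metric_CauchyI)
    fix e :: real assume e: "e > 0"
    have "(\<lambda>k. (norm (s k))\<^sup>2) \<longlonglongrightarrow> d\<^sup>2" using lim by (intro tendsto_intros)
    \<comment> \<open>The bound \<open>mid\<close> puts weight 2 on each of two deviations, so a
      tolerance of \<open>e\<^sup>2 / 4\<close> adds up to \<open>e\<^sup>2\<close>.\<close>
    moreover have "e\<^sup>2 / 4 > 0" using e by simp
    ultimately obtain N where N: "\<And>k. k \<ge> N \<Longrightarrow> \<bar>(norm (s k))\<^sup>2 - d\<^sup>2\<bar> < e\<^sup>2 / 4"
      unfolding LIMSEQ_def dist_real_def by meson
    have "dist (s i) (s j) < e" if "i \<ge> N" "j \<ge> N" for i j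
    proof -
      have "(norm (s i - s j))\<^sup>2 < e\<^sup>2" using mid[of i j] N[OF that(1)] N[OF that(2)] by linarith
      then show ?thesis using e by (simp add: dist_norm power_less_imp_less_base)
    qed
    then show "\<exists>N. \<forall>i\<ge>N. \<forall>j\<ge>N. dist (s i) (s j) < e" by blast
  qed
  then obtain z where z: "s \<longlonglongrightarrow> z" using Cauchy_convergent convergentD by blast
  have "z \<in> S" using S(1) s(1) z closed_sequentially by blast
  moreover have "norm z = d" using LIMSEQ_unique[OF tendsto_norm[OF z] lim] .
  ultimately show ?thesis using that d_le by auto
qed

text \<open>The shortest vector \<open>z\<close> of the hyperplane \<open>f = 1\<close> is
  orthogonal to the kernel of \<open>f\<close>, and \<open>x - f x *\<^sub>R z\<close> lies in that
  kernel; rescaling \<open>z\<close> gives the representing vector.\<close>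

lemma riesz_representation:
  fixes f :: "'a::{real_inner,banach} \<Rightarrow> real"
  assumes "bounded_linear f"
  obtains y where "\<And>x. f x = inner x y"
proof (cases "\<forall>x. f x = 0")
  case True
  then show ?thesis using that[of 0] by simp
next
  case False
  interpret f: bounded_linear f by fact
  from False obtain u where u: "f u \<noteq> 0" by blast
  let ?S = "f -` {1}"
  have "f (u /\<^sub>R f u) = 1" using u by (simp add: f.scaleR)
  then have ne: "?S \<noteq> {}" by blast
  have cl: "closed ?S"
    using continuous_closed_vimage[of "{1::real}" f] f.isCont[OF continuous_ident] by auto
  have cv: "convex ?S"
    by (auto simp: convex_def f.add f.scaleR)
  obtain z where z: "f z = 1" "\<And>x. f x = 1 \<Longrightarrow> norm z \<le> norm x"
    using closed_convex_minimal_norm[OF cl cv ne] by auto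
  have z0: "norm z \<noteq> 0" using z(1) f.zero by force
  have orth: "inner v z = 0" if v: "f v = 0" for v
  proof (cases "v = 0")
    case False
    \<comment> \<open>This value minimizes the quadratic function
      \<open>t \<mapsto> (norm (z + t *\<^sub>R v))\<^sup>2\<close>.\<close>
    define t where "t = - (inner v z / inner v v)"
    have vv: "inner v v > 0" using False by simp
    have "f (z + t *\<^sub>R v) = 1" using v z(1) by (simp add: f.add f.scaleR)
    then have "norm z \<le> norm (z + t *\<^sub>R v)" by (rule z(2))
    then have "(norm z)\<^sup>2 \<le> (norm (z + t *\<^sub>R v))\<^sup>2" by (intro power_mono) auto
    also have "\<dots> = (norm z)\<^sup>2 + 2 * t * inner v z + t * (t * inner v v)"
      by (simp add: power2_norm_eq_inner inner_add_left inner_add_right inner_commute)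
    also have "\<dots> = (norm z)\<^sup>2 - (inner v z)\<^sup>2 / inner v v"
      using vv by (simp add: t_def power2_eq_square field_simps)
    finally have "(inner v z)\<^sup>2 / inner v v \<le> 0" by simp
    then show ?thesis using vv by (simp add: divide_le_0_iff)
  qed simp
  show ?thesis
  proof (rule that[of "z /\<^sub>R (norm z)\<^sup>2"])
    fix x
    have "inner (x - f x *\<^sub>R z) z = 0" by (rule orth) (simp add: f.diff f.scaleR z(1))
    then have "inner x z = f x * (norm z)\<^sup>2"
      by (simp add: inner_diff_left power2_norm_eq_inner)
    then show "f x = inner x (z /\<^sub>R (norm z)\<^sup>2)" using z0 by (simp add: field_simps)
  qed
qed

section \<open>Complex inner products and existence of adjoints\<close>

lemma cinner_add_right: "cinner x (y + z) = cinner x y + cinner x (z::'a::complex_inner)"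
  by (metis cinner_add_left cinner_commute complex_cnj_add)

lemma cinner_diff_right: "cinner x (y - z) = cinner x y - cinner x (z::'a::complex_inner)"
  by (metis add_diff_cancel cinner_add_right diff_add_cancel)

lemma cinner_self: "cinner x x = complex_of_real ((norm (x::'a::complex_inner))\<^sup>2)"
proof -
  have "Im (cinner x x) = 0" using cinner_commute[of x x] by (metis Reals_cnj_iff complex_is_Real_iff)
  then show ?thesis by (simp add: complex_eq_iff inner_eq_Re_cinner[symmetric] power2_norm_eq_inner)
qed

lemma cinner_ext:
  fixes u v :: "'a::complex_inner"
  assumes "\<And>x. cinner x u = cinner x v"
  shows "u = v"
proof -
  have "cinner (u - v) (u - v) = 0" by (simp add: cinner_diff_right assms)
  then show ?thesis by (simp add: cinner_self)
qed

lemma cadjoint_works: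
  fixes A :: "'a::chilbert_space \<Rightarrow> 'a"
  assumes "bounded_clinear A"
  shows "cinner (A x) y = cinner x (cadjoint A y)"
proof -
  have A: "bounded_linear A" "\<And>c x. A (c *\<^sub>C x) = c *\<^sub>C A x"
    using assms by (auto simp: bounded_clinear_def)
  have "\<exists>z. \<forall>x. cinner (A x) y = cinner x z" for y
  proof -
    have "bounded_linear (\<lambda>x. inner (A x) y)"
      using bounded_linear_compose[OF bounded_linear_inner_left A(1)] .
    then obtain z where "\<And>x. inner (A x) y = inner x z" by (rule riesz_representation) auto
    then have z: "Re (cinner (A x) y) = Re (cinner x z)" for x by (simp add: inner_eq_Re_cinner)
    \<comment> \<open>Riesz over the reals settles only the real parts; complex linearity at
      \<open>\<i> *\<^sub>C x\<close> supplies the imaginary ones.\<close>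
    then have "Im (cinner (A x) y) = Im (cinner x z)" for x
      using z[of "\<i> *\<^sub>C x"] by (simp add: A(2) cinner_scaleC_left)
    with z show ?thesis by (auto simp: complex_eq_iff)
  qed
  then obtain B where B: "\<forall>x y. cinner (A x) y = cinner x (B y)" by metis
  moreover have "C = B" if "\<forall>x y. cinner (A x) y = cinner x (C y)" for C
    by (rule ext, rule cinner_ext) (use that B in simp)
  ultimately have "\<forall>x y. cinner (A x) y = cinner x (cadjoint A y)"
    unfolding cadjoint_def by (rule theI)
  then show ?thesis by blast
qed

section \<open>Polynomials in a positive contraction\<close>

text \<open>Horner's scheme. Real coefficients keep the value self-adjoint when \<open>Q\<close>
  is.\<close>

definition opeval :: "('a::real_vector \<Rightarrow> 'a) \<Rightarrow> real poly \<Rightarrow> 'a \<Rightarrow> 'a" where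
  "opeval Q p = fold_coeffs (\<lambda>a f x. a *\<^sub>R x + Q (f x)) p (\<lambda>x. 0)"

lemma opeval_0 [simp]: "opeval Q 0 x = 0"
  by (simp add: opeval_def)

context
  fixes Q :: "'a::real_vector \<Rightarrow> 'a"
  assumes Q: "linear Q"
begin

text \<open>For \<open>pCons 0 0 = 0\<close> the fold performs no step, so this case rests on
  \<open>Q 0 = 0\<close>.\<close>

lemma opeval_pCons: "opeval Q (pCons a p) x = a *\<^sub>R x + Q (opeval Q p x)"
proof -
  have "(\<lambda>x. (0::real) *\<^sub>R x + Q 0) = (\<lambda>x. 0)" using linear_0[OF Q] by auto
  then show ?thesis
    by (cases "p = 0 \<and> a = 0") (auto simp: opeval_def linear_0[OF Q] fold_coeffs_pCons_not_0_0_eq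
        fold_coeffs_pCons_coeff_not_0_eq)
qed

lemma opeval_add: "opeval Q (p + q) x = opeval Q p x + opeval Q q x"
proof (induction p arbitrary: q)
  case (pCons a p)
  then show ?case
    by (cases q) (simp add: opeval_pCons linear_add[OF Q] scaleR_add_left)
qed simp

lemma opeval_smult: "opeval Q (smult c p) x = c *\<^sub>R opeval Q p x"
  by (induction p) (simp_all add: opeval_pCons linear_scale[OF Q] scaleR_add_right)

lemma opeval_diff: "opeval Q (p - q) x = opeval Q p x - opeval Q q x"
  using opeval_add[of "p - q" q x] by simp

lemma opeval_mult: "opeval Q (p * q) x = opeval Q p (opeval Q q x)"
  by (induction p) (simp_all add: opeval_pCons opeval_add opeval_smult)

lemma opeval_commute: "opeval Q p (Q x) = Q (opeval Q p x)"
  by (induction p) (simp_all add: opeval_pCons linear_add[OF Q] linear_scale[OF Q] linear_0[OF Q])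

lemma opeval_1: "opeval Q 1 x = x"
  by (simp add: one_pCons opeval_pCons linear_0[OF Q])

lemma opeval_X: "opeval Q [:0, 1:] x = Q x"
  by (simp add: opeval_pCons linear_0[OF Q])

lemma opeval_power: "opeval Q (p ^ k) x = (opeval Q p ^^ k) x"
  by (induction k) (simp_all add: opeval_1 opeval_mult)

end

lemma inner_opeval_left:
  fixes Q :: "'a::real_inner \<Rightarrow> 'a"
  assumes "linear Q" "\<And>x y. inner (Q x) y = inner x (Q y)"
  shows "inner (opeval Q p x) y = inner x (opeval Q p y)"
  by (induction p arbitrary: x y)
    (simp_all add: opeval_pCons[OF assms(1)] opeval_commute[OF assms(1)] inner_add_left
      inner_add_right assms(2))

text \<open>Sums of terms \<open>r\<^sup>2\<close>, \<open>r\<^sup>2 X\<close> and \<open>r\<^sup>2 (1 - X)\<close>: such a polynomial is visibly positive at every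
  operator between \<open>0\<close> and \<open>1\<close>. Stability under products rests on
  \<open>X (1 - X) = (1 - X)\<^sup>2 X + X\<^sup>2 (1 - X)\<close>.\<close>

inductive_set unit_cone :: "real poly set" where
  zero: "0 \<in> unit_cone"
| step: "p \<in> unit_cone \<Longrightarrow> q \<in> {1, [:0, 1:], 1 - [:0, 1:]} \<Longrightarrow> p + r\<^sup>2 * q \<in> unit_cone"

lemma unit_cone_add:
  assumes "p \<in> unit_cone" "p' \<in> unit_cone"
  shows "p' + p \<in> unit_cone"
  using assms(1)
proof (induction p rule: unit_cone.induct)
  case (step p q r)
  then have "(p' + p) + r\<^sup>2 * q \<in> unit_cone" by (intro unit_cone.step)
  then show ?case by (simp only: add.assoc)
qed (use assms(2) in simp)

lemma unit_cone_gen: "q \<in> {1, [:0, 1:], 1 - [:0, 1:]} \<Longrightarrow> r\<^sup>2 * q \<in> unit_cone"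
  using unit_cone.step[OF unit_cone.zero] by simp

lemma unit_cone_1: "1 \<in> unit_cone" and unit_cone_X: "[:0, 1:] \<in> unit_cone"
  and unit_cone_1_minus_X: "1 - [:0, 1:] \<in> unit_cone"
  using unit_cone_gen[of _ 1] by simp_all

lemma unit_cone_square_mult: "p \<in> unit_cone \<Longrightarrow> r\<^sup>2 * p \<in> unit_cone"
proof (induction p rule: unit_cone.induct)
  case (step p q s)
  then have "r\<^sup>2 * p + (r * s)\<^sup>2 * q \<in> unit_cone" by (intro unit_cone.step)
  then show ?case by (simp add: algebra_simps power_mult_distrib)
qed (simp add: unit_cone.zero)

lemma unit_cone_gen_mult:
  fixes q q' :: "real poly"
  assumes "q \<in> {1, [:0, 1:], 1 - [:0, 1:]}" "q' \<in> {1, [:0, 1:], 1 - [:0, 1:]}"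
  shows "q * q' \<in> unit_cone"
proof -
  let ?X = "[:0, 1:] :: real poly"
  have sq: "x * x \<in> unit_cone" for x
    using unit_cone_gen[of 1 x] by (simp add: power2_eq_square)
  have eq: "x * (1 - x) = (1 - x)\<^sup>2 * x + x\<^sup>2 * (1 - x)" for x :: "real poly"
    by (simp add: power2_eq_square algebra_simps)
  have "?X * (1 - ?X) \<in> unit_cone"
    unfolding eq by (intro unit_cone_add unit_cone_gen) auto
  moreover from this have "(1 - ?X) * ?X \<in> unit_cone" by (simp only: mult.commute)
  ultimately show ?thesis
    using assms sq unit_cone_1 unit_cone_X unit_cone_1_minus_X by (elim insertE emptyE; simp only: mult_1_left mult_1_right)
qed

text \<open>Two nested inductions, one per factor, reduce the claim to products of generators;
  \<open>unit_cone_square_mult\<close> absorbs the squared coefficients.\<close>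

lemma unit_cone_mult: "p \<in> unit_cone \<Longrightarrow> p' \<in> unit_cone \<Longrightarrow> p * p' \<in> unit_cone"
proof (induction p rule: unit_cone.induct)
  case (step p q r)
  note q = step.hyps(2)
  have "q * p' \<in> unit_cone" using step.prems
  proof (induction p' rule: unit_cone.induct)
    case (step p'' q' s)
    from unit_cone_square_mult[OF unit_cone_gen_mult[OF q step.hyps(2)]] step.IH
    have "q * p'' + s\<^sup>2 * (q * q') \<in> unit_cone" by (rule unit_cone_add)
    then show ?case by (simp add: algebra_simps)
  qed (simp add: unit_cone.zero)
  then have "p * p' + r\<^sup>2 * (q * p') \<in> unit_cone"
    using step by (intro unit_cone_add unit_cone_square_mult) auto
  then show ?case by (simp add: algebra_simps)
qed (simp add: unit_cone.zero)

lemma unit_cone_smult: "p \<in> unit_cone \<Longrightarrow> c \<ge> 0 \<Longrightarrow> smult c p \<in> unit_cone"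
  using unit_cone_square_mult[of p "[:sqrt c:]"] by (simp add: power2_eq_square)

lemma unit_cone_power: "p \<in> unit_cone \<Longrightarrow> p ^ k \<in> unit_cone"
  by (induction k) (auto intro: unit_cone_1 unit_cone_mult)

lemma unit_cone_sum: "(\<And>i. i \<in> I \<Longrightarrow> f i \<in> unit_cone) \<Longrightarrow> sum f I \<in> unit_cone"
  by (induction I rule: infinite_finite_induct) (auto intro: unit_cone.zero unit_cone_add)

text \<open>Membership of a difference in the cone acts as an inequality \<open>p \<le> p'\<close>;
  one factor is changed at a time.\<close>

lemma unit_cone_mult_mono:
  assumes "p \<in> unit_cone" "q' \<in> unit_cone" "p' - p \<in> unit_cone" "q' - q \<in> unit_cone"
  shows "p' * q' - p * q \<in> unit_cone"
proof -
  have "p' * q' - p * q = (p' - p) * q' + p * (q' - q)" by (simp add: algebra_simps)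
  then show ?thesis using assms by (simp add: unit_cone_add unit_cone_mult)
qed

lemma unit_cone_power_mono:
  assumes "p \<in> unit_cone" "p' \<in> unit_cone" "p' - p \<in> unit_cone"
  shows "p' ^ k - p ^ k \<in> unit_cone"
  by (induction k) (auto simp: unit_cone.zero intro!: unit_cone_mult_mono unit_cone_power assms)

text \<open>By self-adjointness a summand \<open>r\<^sup>2 * q\<close> contributes the quadratic
  form of \<open>q\<close> at the vector \<open>opeval Q r x\<close>, where \<open>q\<close>
  evaluates to the identity, to \<open>Q\<close> or to their difference, all of them
  positive.\<close>

lemma inner_opeval_nonneg:
  fixes Q :: "'a::real_inner \<Rightarrow> 'a"
  assumes Q: "linear Q" "\<And>x y. inner (Q x) y = inner x (Q y)"
    and pos: "\<And>x. 0 \<le> inner (Q x) x" "\<And>x. inner (Q x) x \<le> inner x x"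
    and p: "p \<in> unit_cone"
  shows "0 \<le> inner (opeval Q p x) x"
  using p
proof (induction p rule: unit_cone.induct)
  case (step p q r)
  have "opeval Q (r\<^sup>2 * q) x = opeval Q r (opeval Q q (opeval Q r x))"
    by (simp add: power2_eq_square mult.assoc mult.commute[of r q] opeval_mult[OF Q(1)])
  then have "inner (opeval Q (r\<^sup>2 * q) x) x = inner (opeval Q q (opeval Q r x)) (opeval Q r x)"
    by (simp add: inner_opeval_left[OF Q])
  also have "\<dots> \<ge> 0"
    using step.hyps(2) pos
    by (elim insertE emptyE)
      (simp_all only: opeval_diff[OF Q(1)] opeval_1[OF Q(1)] opeval_X[OF Q(1)] inner_diff_left
        inner_ge_zero diff_ge_0_iff_ge)
  finally show ?case using step.IH by (simp add: opeval_add[OF Q(1)] inner_add_left)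
qed simp

section \<open>Approximating the root of a positive operator\<close>

text \<open>The iterates are polynomials in \<open>X\<^sup>n\<close>. The errors \<open>e\<^sub>k = X - x\<^sub>k\<close> decrease, and
  \<open>n (x\<^sub>k\<^sub>+\<^sub>1 - x\<^sub>k) = X\<^sup>n - x\<^sub>k\<^sup>n \<ge> e\<^sub>k\<^sup>n\<close>, whence \<open>k e\<^sub>k\<^sup>n \<le> n x\<^sub>k\<close>.\<close>

fun root_iter :: "nat \<Rightarrow> nat \<Rightarrow> real poly" where
  "root_iter n 0 = 0"
| "root_iter n (Suc k) = root_iter n k + smult (1 / real n) ([:0, 1:] ^ n - root_iter n k ^ n)"

text \<open>One step multiplies the error \<open>X - x\<^sub>k\<close> by \<open>1 - s / n\<close>,
  where \<open>s\<close> is a sum of \<open>n\<close> products of powers of \<open>x\<^sub>k\<close>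
  and \<open>X\<close>, each at most 1. So this factor lies in the cone.\<close>

lemma root_iter_cone:
  assumes n: "n > 0"
  shows "root_iter n k \<in> unit_cone \<and> [:0, 1:] - root_iter n k \<in> unit_cone"
proof (induction k)
  case 0
  then show ?case by (simp add: unit_cone.zero unit_cone_X)
next
  case (Suc k)
  let ?X = "[:0, 1:] :: real poly" and ?x = "root_iter n k"
  let ?s = "\<Sum>i<n. ?x ^ (n - Suc i) * ?X ^ i"
  have fact: "?X ^ n - ?x ^ n = (?X - ?x) * ?s" by (rule power_diff_sumr2)
  have x1: "1 - ?x \<in> unit_cone"
    using unit_cone_add[OF _ unit_cone_1_minus_X, of "?X - ?x"] Suc by (simp add: algebra_simps)
  \<comment> \<open>The constant is written \<open>1 * 1\<close> so that monotonicity of products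
    applies factor by factor.\<close>
  have "1 * 1 - ?x ^ (n - Suc i) * ?X ^ i \<in> unit_cone" for i
    using unit_cone_power_mono[of ?x 1 "n - Suc i"] unit_cone_power_mono[of ?X 1 i] x1 Suc
    by (intro unit_cone_mult_mono) (simp_all add: unit_cone_1 unit_cone_X unit_cone_1_minus_X unit_cone_power)
  then have "(\<Sum>i<n. 1 - ?x ^ (n - Suc i) * ?X ^ i) \<in> unit_cone"
    by (intro unit_cone_sum) simp
  then have "smult (1 / real n) (of_nat n - ?s) \<in> unit_cone"
    by (intro unit_cone_smult) (simp_all add: sum_subtractf)
  moreover have "smult (1 / real n) (of_nat n - ?s) = 1 - smult (1 / real n) ?s"
    using n by (simp add: smult_diff_right of_nat_poly)
  ultimately have "(?X - ?x) * (1 - smult (1 / real n) ?s) \<in> unit_cone"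
    using Suc unit_cone_mult by simp
  moreover have "?X - root_iter n (Suc k) = (?X - ?x) * (1 - smult (1 / real n) ?s)"
    by (simp only: root_iter.simps fact) (simp add: algebra_simps)
  moreover have "?X ^ n - ?x ^ n \<in> unit_cone"
    using Suc unit_cone_X by (intro unit_cone_power_mono) auto
  ultimately show ?case using Suc by (simp add: unit_cone_add unit_cone_smult)
qed

text \<open>Passing from \<open>k\<close> to \<open>k + 1\<close> adds two members of the cone: the
  surplus of \<open>X\<^sup>n - x\<^sub>k\<^sup>n\<close> over \<open>e\<^sub>k\<^sup>n\<close>, and
  \<open>k + 1\<close> times the decrease of the \<open>n\<close>-th power of the error.\<close>

lemma root_iter_bound:
  assumes n: "n > 0"
  shows "smult (real n) (root_iter n k) - smult (real k) (([:0, 1:] - root_iter n k) ^ n) \<in> unit_cone"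
proof (induction k)
  case 0
  then show ?case by (simp add: unit_cone.zero)
next
  case (Suc k)
  let ?X = "[:0, 1:] :: real poly" and ?x = "root_iter n k"
  let ?e = "?X - ?x" and ?e' = "?X - root_iter n (Suc k)"
  have c: "?x \<in> unit_cone" "?e \<in> unit_cone" "?e' \<in> unit_cone"
    using root_iter_cone[OF n, of k] root_iter_cone[OF n, of "Suc k"] by blast+
  have d: "?X ^ n - ?x ^ n \<in> unit_cone"
    using c unit_cone_X by (intro unit_cone_power_mono) auto
  have ee: "?e - ?e' = smult (1 / real n) (?X ^ n - ?x ^ n)" by simp
  have "?e ^ n - ?e' ^ n \<in> unit_cone"
    using c d unit_cone_smult[OF d, of "1 / real n"]
    by (intro unit_cone_power_mono) (simp_all only: ee zero_le_divide_iff of_nat_0_le_iff zero_le_one simp_thms)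
  then have 1: "smult (real (Suc k)) (?e ^ n - ?e' ^ n) \<in> unit_cone"
    by (rule unit_cone_smult) simp
  obtain m where m: "n = Suc m" using n gr0_implies_Suc by blast
  \<comment> \<open>Since \<open>X = e + x\<close>, powers are superadditive: \<open>X\<^sup>n = e
    X\<^sup>m + x X\<^sup>m \<ge> e\<^sup>n + x\<^sup>n\<close>, where
    \<open>n = m + 1\<close>.\<close>
  have "?X ^ m - ?e ^ m \<in> unit_cone" "?X ^ m - ?x ^ m \<in> unit_cone"
    using c unit_cone_X by (auto intro!: unit_cone_power_mono)
  then have "?e * (?X ^ m - ?e ^ m) + ?x * (?X ^ m - ?x ^ m) \<in> unit_cone"
    using c by (intro unit_cone_add unit_cone_mult)
  moreover have "?e * (?X ^ m - ?e ^ m) + ?x * (?X ^ m - ?x ^ m) = ?X ^ n - ?x ^ n - ?e ^ n"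
    by (simp only: m power_Suc) (simp only: algebra_simps)
  ultimately have 2: "?X ^ n - ?x ^ n - ?e ^ n \<in> unit_cone" by simp
  have "smult (real n) (root_iter n (Suc k)) = smult (real n) ?x + (?X ^ n - ?x ^ n)"
    using n by (simp add: smult_add_right)
  then have "smult (real n) (root_iter n (Suc k)) - smult (real (Suc k)) (?e' ^ n)
     = (smult (real n) ?x - smult (real k) (?e ^ n)) + (?X ^ n - ?x ^ n - ?e ^ n)
       + smult (real (Suc k)) (?e ^ n - ?e' ^ n)"
    by (simp only: of_nat_Suc smult_add_left smult_diff_right) (simp only: algebra_simps smult_1_left)
  then show ?case using Suc 1 2 by (simp only: unit_cone_add)
qed

text \<open>\<open>root_iter_bound\<close> controls the quadratic form of the \<open>n\<close>-th
  power of the error, whereas convergence needs that of its square, which is a squared norm.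
  Cauchy-Schwarz halves exponents, so the descent starts at \<open>2 ^ n\<close>, which exceeds
  \<open>n\<close>.\<close>

lemma root_iter_tendsto:
  fixes Q :: "'a::real_inner \<Rightarrow> 'a"
  assumes Q: "linear Q" "\<And>x y. inner (Q x) y = inner x (Q y)"
    and pos: "\<And>x. 0 \<le> inner (Q x) x" "\<And>x. inner (Q x) x \<le> inner x x"
    and n: "n > 0"
  shows "(\<lambda>k. opeval Q (root_iter n k) x) \<longlonglongrightarrow> Q x"
proof -
  let ?O = "opeval Q" and ?x = "root_iter n" and ?X = "[:0, 1:] :: real poly"
  define e where "e k = ?X - ?x k" for k
  define G where "G i k = inner (?O (e k ^ i) x) x" for i k
  note nonneg = inner_opeval_nonneg[OF Q pos]
  have mono: "inner (?O p x) x \<le> inner (?O q x) x" if "q - p \<in> unit_cone" for p q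
    using nonneg[OF that, of x] by (simp add: opeval_diff[OF Q(1)] inner_diff_left)
  have cone: "?x k \<in> unit_cone" "e k \<in> unit_cone" for k
    using root_iter_cone[OF n] by (auto simp: e_def)
  have e1: "1 - e k \<in> unit_cone" and x1: "1 - ?x k \<in> unit_cone" for k
    using unit_cone_add[OF cone(1) unit_cone_1_minus_X, of k]
      unit_cone_add[OF cone(2) unit_cone_1_minus_X, of k]
    by (simp_all add: e_def algebra_simps)
  have Gnn: "0 \<le> G i k" for i k
    unfolding G_def by (intro nonneg unit_cone_power cone)
  have Gn: "G n k \<le> real n * inner x x / real k" if "k > 0" for k
  proof -
    have "real k * G n k = inner (?O (smult (real k) (e k ^ n)) x) x"
      by (simp add: G_def opeval_smult[OF Q(1)])
    also have "\<dots> \<le> inner (?O (smult (real n) (?x k)) x) x"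
      unfolding e_def by (intro mono root_iter_bound n)
    also have "\<dots> = real n * inner (?O (?x k) x) x" by (simp add: opeval_smult[OF Q(1)])
    also have "\<dots> \<le> real n * inner x x"
      using mono[OF x1, of k] by (intro mult_left_mono) (simp_all add: opeval_1[OF Q(1)])
    finally show ?thesis using that by (simp add: field_simps)
  qed
  have norm_G: "(norm (?O (e k ^ i) x))\<^sup>2 = G (2 * i) k" for i k
    by (simp add: G_def power2_norm_eq_inner inner_opeval_left[OF Q] mult_2 power_add opeval_mult[OF Q(1)])
  have top: "G (2 ^ n) \<longlonglongrightarrow> 0"
  proof (rule tendsto_sandwich)
    show "\<forall>\<^sub>F k in sequentially. 0 \<le> G (2 ^ n) k" using Gnn by simp
    \<comment> \<open>In the cone order \<open>e k\<close> lies between 0 and 1, so its powers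
      decrease.\<close>
    have "G (2 ^ n) k \<le> G n k" for k
    proof -
      have "e k ^ n * 1 - e k ^ n * e k ^ (2 ^ n - n) \<in> unit_cone"
        using unit_cone_power_mono[of "e k" 1] cone e1
        by (intro unit_cone_mult_mono unit_cone_power) (simp_all add: unit_cone_1 unit_cone.zero)
      then show ?thesis unfolding G_def by (intro mono) (simp flip: power_add)
    qed
    then show "\<forall>\<^sub>F k in sequentially. G (2 ^ n) k \<le> real n * inner x x / real k"
      using Gn by (intro eventually_sequentiallyI[of 1]) (meson less_le_trans order_trans zero_less_one)
    show "(\<lambda>k. real n * inner x x / real k) \<longlonglongrightarrow> 0" by (rule lim_const_over_n)
  qed simp
  have "1 \<le> n" using n by simp
  \<comment> \<open>Downward induction on the exponent of 2, from \<open>n\<close> to 1.\<close>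
  then have "G (2 ^ 1) \<longlonglongrightarrow> 0"
  proof (rule inc_induct)
    fix i assume IH: "G (2 ^ Suc i) \<longlonglongrightarrow> 0"
    show "G (2 ^ i) \<longlonglongrightarrow> 0"
    proof (rule tendsto_sandwich)
      show "\<forall>\<^sub>F k in sequentially. 0 \<le> G (2 ^ i) k" using Gnn by simp
      have "norm (?O (e k ^ 2 ^ i) x) = sqrt (G (2 ^ Suc i) k)" for k
        using norm_G[of k "2 ^ i"] by (simp add: real_sqrt_unique)
      then have "G (2 ^ i) k \<le> sqrt (G (2 ^ Suc i) k) * norm x" for k
        unfolding G_def by (metis norm_cauchy_schwarz)
      then show "\<forall>\<^sub>F k in sequentially. G (2 ^ i) k \<le> sqrt (G (2 ^ Suc i) k) * norm x" by simp
      show "(\<lambda>k. sqrt (G (2 ^ Suc i) k) * norm x) \<longlonglongrightarrow> 0"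
        using tendsto_mult_right[OF tendsto_real_sqrt[OF IH], of "norm x"] by simp
    qed simp
  qed (rule top)
  then have "(\<lambda>k. (norm (?O (e k) x))\<^sup>2) \<longlonglongrightarrow> 0"
    using norm_G[of _ 1] by simp
  then have "(\<lambda>k. norm (?O (e k) x)) \<longlonglongrightarrow> 0"
    using tendsto_real_sqrt by fastforce
  then have "(\<lambda>k. ?O (e k) x) \<longlonglongrightarrow> 0" by (rule tendsto_norm_zero_cancel)
  then have "(\<lambda>k. Q x - ?O (e k) x) \<longlonglongrightarrow> Q x - 0" by (intro tendsto_intros)
  then show ?thesis by (simp add: e_def opeval_diff[OF Q(1)] opeval_X[OF Q(1)])
qed

text \<open>The iterates arise from \<open>Q ^^ n\<close> by sums, scalar multiples and powers, so
  they preserve \<open>M\<close>; closedness carries this over to their strong limit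
  \<open>Q\<close>.\<close>

lemma positive_contraction_root_preserves:
  fixes Q :: "'a::real_inner \<Rightarrow> 'a"
  assumes Q: "linear Q" "\<And>x y. inner (Q x) y = inner x (Q y)"
    and pos: "\<And>x. 0 \<le> inner (Q x) x" "\<And>x. inner (Q x) x \<le> inner x x"
    and n: "n > 0"
    and M: "subspace M" "closed M" "\<And>x. x \<in> M \<Longrightarrow> (Q ^^ n) x \<in> M"
    and x: "x \<in> M"
  shows "Q x \<in> M"
proof -
  have pw: "(f ^^ i) v \<in> M" if "\<And>v. v \<in> M \<Longrightarrow> f v \<in> M" "v \<in> M" for f i v
    using that by (induction i) auto
  have "opeval Q [:0, 1:] = Q" using opeval_X[OF Q(1)] by blast
  then have X: "opeval Q ([:0, 1:] ^ n) = Q ^^ n"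
    using opeval_power[OF Q(1), of "[:0, 1:]" n] by (intro ext) simp
  have "opeval Q (root_iter n k) v \<in> M" if "v \<in> M" for k v
    using that
  proof (induction k arbitrary: v)
    case 0
    then show ?case using M(1) by (simp add: subspace_0)
  next
    case (Suc k)
    have "(opeval Q (root_iter n k) ^^ n) v \<in> M" using Suc by (intro pw)
    then show ?case
      using Suc M(1,3)
      by (auto simp: opeval_add[OF Q(1)] opeval_smult[OF Q(1)] opeval_diff[OF Q(1)] X
          opeval_power[OF Q(1), of "root_iter n k"] intro!: subspace_add subspace_scale subspace_diff)
  qed
  then show ?thesis
    using closed_sequentially[OF M(2) _ root_iter_tendsto[OF Q pos n]] x by blast
qed

text \<open>Dividing by a norm bound \<open>K\<close> turns \<open>Q\<close> into a contraction; its
  powers change only by scalars, under which a subspace is stable.\<close>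

lemma positive_root_preserves:
  fixes Q :: "'a::real_inner \<Rightarrow> 'a"
  assumes Q: "bounded_linear Q" "\<And>x y. inner (Q x) y = inner x (Q y)"
    and pos: "\<And>x. 0 \<le> inner (Q x) x"
    and n: "n > 0"
    and M: "subspace M" "closed M" "\<And>x. x \<in> M \<Longrightarrow> (Q ^^ n) x \<in> M"
    and x: "x \<in> M"
  shows "Q x \<in> M"
proof -
  interpret Q: bounded_linear Q by fact
  obtain K where K: "K > 0" "\<And>x. norm (Q x) \<le> norm x * K" using Q.pos_bounded by blast
  define R where "R x = (1 / K) *\<^sub>R Q x" for x
  have "linear R" unfolding R_def by (intro linear_compose_scale_right Q.linear_axioms)
  have pw: "(R ^^ i) v = (1 / K) ^ i *\<^sub>R (Q ^^ i) v" for i v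
    by (induction i) (simp_all add: R_def Q.scaleR)
  have "R x \<in> M"
  proof (rule positive_contraction_root_preserves[OF \<open>linear R\<close> _ _ _ n M(1,2) _ x])
    show "inner (R v) v \<le> inner v v" for v
    proof -
      have "inner (Q v) v \<le> norm (Q v) * norm v" by (rule norm_cauchy_schwarz)
      also have "\<dots> \<le> (norm v * K) * norm v" by (intro mult_right_mono K) simp
      also have "\<dots> = K * inner v v" by (simp add: power2_norm_eq_inner[symmetric] power2_eq_square)
      finally show ?thesis using K(1) by (simp add: R_def field_simps)
    qed
    show "(R ^^ n) v \<in> M" if "v \<in> M" for v
      unfolding pw using M(1,3) that by (intro subspace_scale)
  qed (use Q(2) pos K(1) in \<open>simp_all add: R_def\<close>)
  then have "K *\<^sub>R R x \<in> M" by (rule subspace_scale[OF M(1)])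
  then show ?thesis using K(1) by (simp add: R_def)
qed

section \<open>Quasinormality\<close>

lemma cadjoint_inner:
  assumes "bounded_clinear (A :: 'a::chilbert_space \<Rightarrow> 'a)"
  shows "inner (A x) y = inner x (cadjoint A y)"
  by (simp add: inner_eq_Re_cinner cadjoint_works[OF assms])

lemma inner_ext_left:
  fixes u v :: "'a::real_inner"
  assumes "\<And>y. inner u y = inner v y"
  shows "u = v"
proof -
  have "inner (u - v) (u - v) = 0" by (simp add: inner_diff_left assms)
  then show ?thesis by simp
qed

text \<open>The squared norm of \<open>cadjoint A x\<close> equals
  \<open>inner (A (cadjoint A x)) x\<close>, so Cauchy-Schwarz shows that any bound \<open>K\<close>
  of \<open>A\<close> also bounds its adjoint.\<close>

lemma bounded_linear_cadjoint:
  fixes A :: "'a::chilbert_space \<Rightarrow> 'a"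
  assumes A: "bounded_clinear A"
  shows "bounded_linear (cadjoint A)"
proof -
  interpret A: bounded_linear A using A by (simp add: bounded_clinear_def)
  note adj = cadjoint_inner[OF A, symmetric]
  obtain K where K: "K > 0" "\<And>x. norm (A x) \<le> norm x * K" using A.pos_bounded by blast
  show ?thesis
  proof (rule bounded_linear_intro[where K = K])
    show "cadjoint A (x + y) = cadjoint A x + cadjoint A y" for x y
      by (rule inner_ext_left) (simp add: inner_commute[of _ y] inner_commute[of "cadjoint _ _"]
          inner_add_left inner_add_right adj inner_commute[of "_ + _"])
    show "cadjoint A (r *\<^sub>R x) = r *\<^sub>R cadjoint A x" for r x
      by (rule inner_ext_left) (simp add: inner_commute[of "cadjoint _ _"] adj)
    show "norm (cadjoint A x) \<le> norm x * K" for x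
    proof -
      have "norm (cadjoint A x) * norm (cadjoint A x) = inner (A (cadjoint A x)) x"
        using adj[of "cadjoint A x" x] by (simp add: power2_norm_eq_inner[symmetric] power2_eq_square)
      also have "\<dots> \<le> norm (A (cadjoint A x)) * norm x" by (rule norm_cauchy_schwarz)
      also have "\<dots> \<le> (norm (cadjoint A x) * K) * norm x" by (intro mult_right_mono K) simp
      finally have "norm (cadjoint A x) * norm (cadjoint A x) \<le> norm (cadjoint A x) * (norm x * K)"
        by (simp add: ac_simps)
      then show ?thesis using K(1) by (cases "cadjoint A x = 0") simp_all
    qed
  qed
qed

lemma bounded_clinear_funpow:
  fixes A :: "'a::complex_inner \<Rightarrow> 'a"
  assumes "bounded_clinear A"
  shows "bounded_clinear (A ^^ i)"
proof -
  have A: "bounded_linear A" using assms by (simp add: bounded_clinear_def)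
  have "bounded_linear (A ^^ i)"
    by (induction i) (simp_all add: id_def comp_def bounded_linear_compose[OF A])
  moreover have "(A ^^ i) (c *\<^sub>C x) = c *\<^sub>C (A ^^ i) x" for c x
    using assms by (induction i) (simp_all add: bounded_clinear_def)
  ultimately show ?thesis by (simp add: bounded_clinear_def)
qed

lemma funpow_comp_commute:
  assumes "f \<circ> g = g \<circ> f"
  shows "(f \<circ> g) ^^ i = (f ^^ i) \<circ> (g ^^ i)"
proof (induction i)
  case (Suc i)
  have fg: "f (g x) = g (f x)" for x using assms by (metis comp_apply)
  have "g ((f ^^ i) x) = (f ^^ i) (g x)" for x by (induction i) (simp_all add: fg[symmetric])
  then show ?case using Suc by (simp add: fun_eq_iff)
qed simp

text \<open>Polarization: \<open>dot_norm\<close> expresses inner products through norms.\<close>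

lemma isometry_inner:
  fixes V :: "'a::real_inner \<Rightarrow> 'b::real_inner"
  assumes "linear V" "\<And>x. norm (V x) = norm x"
  shows "inner (V x) (V y) = inner x y"
  by (simp add: dot_norm assms linear_add[OF assms(1), symmetric])

section \<open>From the normal extension back to \<open>A\<close>\<close>

theorem theorem1p2:
  fixes A :: "'h::chilbert_space \<Rightarrow> 'h" and n :: nat
  assumes "bounded_clinear A"
    and "subnormal TYPE('k::chilbert_space) A"
    and "n > 1"
    and "quasinormal (A ^^ n)"
  shows "quasinormal A"
proof -
  obtain V :: "'h \<Rightarrow> 'k" and N :: "'k \<Rightarrow> 'k"
    where V: "bounded_clinear V" "\<And>x. norm (V x) = norm x"
      and N: "bounded_clinear N" "normal_operator N"
      and NV: "\<And>x. N (V x) = V (A x)"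
    using assms(2) unfolding subnormal_def by blast
  define L where "L = cadjoint N"
  define Q where "Q = L \<circ> N"
  define B where "B = A ^^ n"
  have blV: "bounded_linear V" and blN: "bounded_linear N"
    using V(1) N(1) by (auto simp: bounded_clinear_def)
  have lV: "linear V" using blV by (rule bounded_linear.linear)
  note innerV = isometry_inner[OF lV V(2)]
  have NL: "N (L x) = L (N x)" for x
    using N(2) unfolding normal_operator_def L_def by (metis comp_apply)
  have adj: "inner (N x) y = inner x (L y)" for x y
    unfolding L_def by (rule cadjoint_inner[OF N(1)])
  have adjn: "inner ((N ^^ i) x) y = inner x ((L ^^ i) y)" for i x y
    by (induction i arbitrary: x y) (simp_all add: adj, metis adj funpow_swap1)
  have NVn: "(N ^^ i) (V x) = V ((A ^^ i) x)" for i x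
    by (induction i) (simp_all add: NV)
  have Bc: "bounded_clinear B" unfolding B_def by (rule bounded_clinear_funpow[OF assms(1)])
  define S where "S x = cadjoint B (B x)" for x
  have BS: "B (S x) = S (B x)" for x
    using assms(4) unfolding quasinormal_def B_def[symmetric] S_def by (metis comp_apply)
  have adjB: "inner (B x) y = inner x (cadjoint B y)" for x y by (rule cadjoint_inner[OF Bc])
  have Qn: "(Q ^^ n) x = (L ^^ n) ((N ^^ n) x)" for x
    unfolding Q_def by (subst funpow_comp_commute) (auto simp: fun_eq_iff NL)
  text \<open>\<open>Q\<^sup>n V x\<close> and \<open>V S x\<close> agree because their inner product and their squared norms
    all equal \<open>(norm (S x))\<^sup>2\<close>.\<close>
  have QnV: "(Q ^^ n) (V x) = V (S x)" for x
  proof -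
    let ?T = "(Q ^^ n) (V x)" and ?u = "V (B x)"
    have comm: "(N ^^ n) ((L ^^ n) v) = (L ^^ n) ((N ^^ n) v)" for v
    proof -
      have "(N \<circ> L) ^^ n = (L \<circ> N) ^^ n" by (simp add: comp_def NL)
      moreover have "N \<circ> L = L \<circ> N" by (simp add: comp_def NL)
      ultimately show ?thesis using funpow_comp_commute[of N L n] funpow_comp_commute[of L N n]
        by (metis comp_apply)
    qed
    have T: "?T = (L ^^ n) ?u" by (simp add: Qn NVn B_def)
    have "inner ?T ?T = inner ((N ^^ n) ((L ^^ n) ?u)) ?u" by (simp add: T adjn)
    \<comment> \<open>Normality: \<open>N ^^ n\<close> and its adjoint \<open>L ^^ n\<close> send a
      vector to vectors of equal norm.\<close>
    also have "\<dots> = inner ((N ^^ n) ?u) ((N ^^ n) ?u)"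
      by (simp add: comm adjn inner_commute)
    also have "\<dots> = inner (B (B x)) (B (B x))" by (simp add: NVn B_def innerV)
    also have "\<dots> = inner (B x) (S (B x))" by (simp add: adjB S_def)
    \<comment> \<open>Quasinormality of \<open>B\<close> enters here, moving \<open>S\<close> past
      \<open>B\<close>.\<close>
    also have "\<dots> = inner (B (S x)) (B x)" by (simp add: BS[symmetric] inner_commute)
    also have "\<dots> = inner (S x) (S x)" by (simp add: adjB S_def)
    finally have TT: "inner ?T ?T = inner (S x) (S x)" .
    have "inner (V (S x)) ?T = inner (V (B (S x))) ?u" by (simp add: T adjn[symmetric] NVn B_def)
    also have "\<dots> = inner (S x) (S x)" by (simp add: innerV adjB S_def)
    finally have "inner (?T - V (S x)) (?T - V (S x)) = 0"
      using TT by (simp add: inner_diff_left inner_diff_right innerV inner_commute)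
    then show ?thesis by simp
  qed
  \<comment> \<open>By \<open>QnV\<close> the closed subspace \<open>range V\<close> is invariant
    under \<open>Q ^^ n\<close>, and the root \<open>Q\<close> inherits this.\<close>
  have QV: "Q v \<in> range V" if "v \<in> range V" for v
  proof (rule positive_root_preserves[OF _ _ _ _ _ _ _ that])
    show "bounded_linear Q"
      unfolding Q_def comp_def L_def
      by (rule bounded_linear_compose[OF bounded_linear_cadjoint[OF N(1)] blN])
    show "inner (Q x) y = inner x (Q y)" for x y
      unfolding Q_def by (metis adj comp_apply inner_commute)
    show "0 \<le> inner (Q x) x" for x
      unfolding Q_def by (metis adj comp_apply inner_commute inner_ge_zero)
    show "n > 0" using assms(3) by simp
    show "subspace (range V)" by (rule linear_subspace_image[OF lV subspace_UNIV])
    \<comment> \<open>An isometry is bounded below with constant 1, so it maps a complete space onto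
      a complete set.\<close>
    have "complete (range V)"
      using complete_isometric_image[of 1 UNIV V] blV V(2) by (simp add: complete_UNIV)
    then show "closed (range V)" by (rule complete_imp_closed)
    show "(Q ^^ n) w \<in> range V" if "w \<in> range V" for w using that QnV by auto
  qed
  \<comment> \<open>Testing against \<open>V y\<close> identifies the compression of
    \<open>Q\<close> with \<open>cadjoint A \<circ> A\<close>; invariance of \<open>range V\<close>
    turns the compression into a restriction.\<close>
  have QVA: "Q (V x) = V (cadjoint A (A x))" for x
  proof -
    obtain r where r: "Q (V x) = V r" using QV by blast
    have "inner r y = inner (cadjoint A (A x)) y" for y
    proof -
      have "inner r y = inner (V y) (Q (V x))" by (simp add: r innerV inner_commute)
      also have "\<dots> = inner (A y) (A x)" by (simp add: Q_def adj[symmetric] NV innerV)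
      also have "\<dots> = inner (cadjoint A (A x)) y"
        using cadjoint_inner[OF assms(1), of y "A x"] by (simp add: inner_commute)
      finally show ?thesis .
    qed
    then show ?thesis using r inner_ext_left by metis
  qed
  \<comment> \<open>By normality \<open>Q\<close> commutes with \<open>N\<close>; on
    \<open>range V\<close> this is the claim, since \<open>V\<close> is injective.\<close>
  have "A (cadjoint A (A x)) = cadjoint A (A (A x))" for x
  proof -
    have "V (A (cadjoint A (A x))) = N (Q (V x))" by (simp add: NV QVA)
    also have "\<dots> = Q (N (V x))" by (simp add: Q_def NL)
    also have "\<dots> = V (cadjoint A (A (A x)))" by (simp add: NV QVA)
    finally have "V (A (cadjoint A (A x)) - cadjoint A (A (A x))) = 0"
      by (simp add: linear_diff[OF lV])
    then show ?thesis using V(2) by (metis norm_eq_zero right_minus_eq)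
  qed
  then show ?thesis by (simp add: quasinormal_def fun_eq_iff)
qed

end
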